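(* Let $a,b,c$ be non-negative integers with $a\le b$. Then \[ M(S'_{a,b,c})=\frac{M(S_{a,b,c})}{2^{a+1}}\cdot\frac{2c+b+2}{c+b+1}\cdot\prod_{i=1}^{a}\frac{2c+b+1-i}{c+b+1-i}, \] where $M(S_{a,b,c})$ is the number of lozenge tilings of $S_{a,b,c}$. Moreover, for every non-negative integers $b,c$, $M(S'_{b+1,b,c})=M(S'_{b,b,c})$.
   Context: Work in the triangular lattice of unit equilateral triangles whose lattice lines are the horizontal lines $y=kh$ ($k\in\mathbb Z$, $h=\sqrt3/2$) and the lines at $60^\circ$ and $120^\circ$ to them; lattice points are $(i+k/2,\,kh)$, $i,k\in\mathbb Z$. A lozenge is the union of two unit triangles sharing an edge; a lozenge tiling of a region is a covering by non-overlapping lozenges. If each lozenge is assigned a positive weight, the weight of a tiling is the product of the weights of its lozenges, and $M(R)$ (the matching generating function) is the sum of the weights of all tilings of $R$; for an unweighted region (all weights $1$) $M(R)$ is the number of tilings. The region $S_{a,b,c}$ (for non-negative integers $a,b,c$ with $a\le b+1$): let $H$ be the lattice hexagon with vertices $B=(0,0)$, $C=(c+1,0)$, $D=(c+1+b/2,\,bh)$, $E=(c+(b-a)/2,\,(a+b+2)h)$, $F=((b-a)/2,\,(a+b+2)h)$, $A=(-(a+1)/2,\,(a+1)h)$ (side lengths $c+1,b,a+2,c,b+1,a+1$ for sides $BC,CD,DE,EF,FA,AB$). Let $Z$ be the zigzag lattice path from $B$ made of $2a+1$ unit steps alternating between $(-1/2,h)$ and $(1/2,h)$, starting and ending with $(-1/2,h)$,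 ending at $(-1/2,(2a+1)h)$ on side $FA$. Keep the part of $H$ bounded by $B\to C\to D\to E\to F$, then along $FA$ down to $(-1/2,(2a+1)h)$, then back along $Z$ to $B$; then remove the upward-pointing unit triangle with vertices $(c+(b-1)/2,(b+1)h)$, $(c+(b+1)/2,(b+1)h)$, $(c+b/2,(b+2)h)$ (the unit triangle with an edge on side $DE$, second from the corner $D$). This is $S_{a,b,c}$, unweighted. The weighted region $S'_{a,b,c}$: the same region, where for each $k=1,\dots,a+1$ the vertical lozenge $L_k$ formed by the down-pointing triangle with vertices $(-1/2,(2k-1)h),(1/2,(2k-1)h),(0,(2k-2)h)$ and the up-pointing triangle with vertices $(-1/2,(2k-1)h),(1/2,(2k-1)h),(0,2kh)$ is given weight $1/2$ whenever both of these triangles belong to the region (these are the vertical lozenges along the west side); all other lozenges have weight $1$. *)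

theory Defs
  imports Complex_Main "HOL-Library.Disjoint_Sets"
begin

text \<open>
  The lattice point $(i + k/2, kh)$, $h = \sqrt 3/2$, is encoded by its lattice coordinates
  $(i, k)$; \<open>cartesian\<close> is the decoding. It is linear and orientation preserving, so
  \<open>left of a directed line\<close> may be tested in lattice coordinates.
\<close>

type_synonym lpoint = "int \<times> int"

definition cartesian :: "lpoint \<Rightarrow> real \<times> real" where
  "cartesian P = (real_of_int (fst P) + real_of_int (snd P) / 2, real_of_int (snd P) * (sqrt 3 / 2))"

text \<open>
  A unit triangle is given by the left end point $(i,k)$ of its horizontal edge.
\<close>

datatype triangle = Up int int | Down int int

fun vertices :: "triangle \<Rightarrow> lpoint set" where
  "vertices (Up i k) = {(i, k), (i + 1, k), (i, k + 1)}"
| "vertices (Down i k) = {(i, k), (i + 1, k), (i + 1, k - 1)}"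

text \<open>
  Two distinct unit triangles share an edge iff they have exactly two common vertices.
\<close>

definition lozenge :: "triangle set \<Rightarrow> bool" where
  "lozenge L \<longleftrightarrow> (\<exists>s t. s \<noteq> t \<and> card (vertices s \<inter> vertices t) = 2 \<and> L = {s, t})"

definition lozenge_tilings :: "triangle set \<Rightarrow> triangle set set set" where
  "lozenge_tilings R = {T. partition_on R T \<and> (\<forall>L\<in>T. lozenge L)}"

definition matching_gf :: "(triangle set \<Rightarrow> real) \<Rightarrow> triangle set \<Rightarrow> real" where
  "matching_gf w R = (\<Sum>T\<in>lozenge_tilings R. \<Prod>L\<in>T. w L)"

definition vB :: "nat \<Rightarrow> nat \<Rightarrow> nat \<Rightarrow> lpoint" where "vB a b c = (0, 0)"
definition vC :: "nat \<Rightarrow> nat \<Rightarrow> nat \<Rightarrow> lpoint" where "vC a b c = (int c + 1, 0)"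
definition vD :: "nat \<Rightarrow> nat \<Rightarrow> nat \<Rightarrow> lpoint" where "vD a b c = (int c + 1, int b)"
definition vE :: "nat \<Rightarrow> nat \<Rightarrow> nat \<Rightarrow> lpoint" where
  "vE a b c = (int c - int a - 1, int a + int b + 2)"
definition vF :: "nat \<Rightarrow> nat \<Rightarrow> nat \<Rightarrow> lpoint" where
  "vF a b c = (- int a - 1, int a + int b + 2)"
definition vA :: "nat \<Rightarrow> nat \<Rightarrow> nat \<Rightarrow> lpoint" where "vA a b c = (- int a - 1, int a + 1)"

lemma cartesian_hexagon_vertices:
  "cartesian (vB a b c) = (0, 0)"
  "cartesian (vC a b c) = (c + 1, 0)"
  "cartesian (vD a b c) = (c + 1 + b / 2, b * (sqrt 3 / 2))"
  "cartesian (vE a b c) = (c + (real b - a) / 2, (a + b + 2) * (sqrt 3 / 2))"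
  "cartesian (vF a b c) = ((real b - a) / 2, (a + b + 2) * (sqrt 3 / 2))"
  "cartesian (vA a b c) = (- (a + 1) / 2, (a + 1) * (sqrt 3 / 2))"
  by (simp_all add: cartesian_def vA_def vB_def vC_def vD_def vE_def vF_def field_simps)

definition weakly_left :: "lpoint \<Rightarrow> lpoint \<Rightarrow> lpoint \<Rightarrow> bool" where
  "weakly_left P Q X \<longleftrightarrow>
     (fst Q - fst P) * (snd X - snd P) - (snd Q - snd P) * (fst X - fst P) \<ge> 0"

text \<open>
  The convex hexagon $BCDEFA$ is traversed counterclockwise. If $b = 0$ or $c = 0$ a side
  degenerates to a point and the corresponding condition holds trivially.
\<close>

definition in_hexagon :: "nat \<Rightarrow> nat \<Rightarrow> nat \<Rightarrow> lpoint \<Rightarrow> bool" where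
  "in_hexagon a b c X \<longleftrightarrow>
     weakly_left (vB a b c) (vC a b c) X \<and>
     weakly_left (vC a b c) (vD a b c) X \<and>
     weakly_left (vD a b c) (vE a b c) X \<and>
     weakly_left (vE a b c) (vF a b c) X \<and>
     weakly_left (vF a b c) (vA a b c) X \<and>
     weakly_left (vA a b c) (vB a b c) X"

text \<open>
  In lattice coordinates the steps $(-1/2, h)$ and $(1/2, h)$ are $(-1, 1)$ and $(0, 1)$.
  The zigzag path $Z$ visits \<open>zigzag 0\<close>, \dots, \<open>zigzag (2 * a + 1)\<close>.
\<close>

primrec zigzag :: "nat \<Rightarrow> lpoint" where
  "zigzag 0 = (0, 0)"
| "zigzag (Suc j) =
     (if even j then (fst (zigzag j) - 1, snd (zigzag j) + 1)
      else (fst (zigzag j), snd (zigzag j) + 1))"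

lemma zigzag_even_odd: "zigzag (2 * j) = (- int j, 2 * int j) \<and>
  zigzag (2 * j + 1) = (- int j - 1, 2 * int j + 1)"
  by (induction j) auto

lemma cartesian_zigzag_end:
  "cartesian (zigzag (2 * a + 1)) = (- 1 / 2, (2 * a + 1) * (sqrt 3 / 2))"
  using zigzag_even_odd[of a] by (simp add: cartesian_def field_simps)

definition east_of_zigzag :: "nat \<Rightarrow> lpoint \<Rightarrow> bool" where
  "east_of_zigzag a X \<longleftrightarrow> (\<forall>j \<le> 2 * a + 1. snd X = int j \<longrightarrow> fst (zigzag j) \<le> fst X)"

text \<open>
  Between two consecutive horizontal lattice lines the boundary of the polygon
  $B, C, D, E, F$, end of $Z$, (back along $Z$ to) $B$ is straight on either side. Hence a unit
  triangle is contained in the polygon iff its three vertices are, although the polygon is not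
  convex.
\<close>

definition polygon_region :: "nat \<Rightarrow> nat \<Rightarrow> nat \<Rightarrow> triangle set" where
  "polygon_region a b c = {t. \<forall>X\<in>vertices t. in_hexagon a b c X \<and> east_of_zigzag a X}"

definition dent :: "nat \<Rightarrow> nat \<Rightarrow> triangle" where
  "dent b c = Up (int c - 1) (int b + 1)"

lemma cartesian_dent:
  "cartesian ` vertices (dent b c) =
     {(c + (real b - 1) / 2, (b + 1) * (sqrt 3 / 2)),
      (c + (real b + 1) / 2, (b + 1) * (sqrt 3 / 2)),
      (c + real b / 2, (b + 2) * (sqrt 3 / 2))}"
  by (simp add: cartesian_def dent_def field_simps)

text \<open>
  \<open>S_region a b c\<close> is $S_{a,b,c}$; it is meaningful for $a \le b + 1$ only.
\<close>

definition S_region :: "nat \<Rightarrow> nat \<Rightarrow> nat \<Rightarrow> triangle set" where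
  "S_region a b c = polygon_region a b c - {dent b c}"

definition west_lozenge :: "nat \<Rightarrow> triangle set" where
  "west_lozenge k = {Down (- int k) (2 * int k - 1), Up (- int k) (2 * int k - 1)}"

lemma cartesian_west_lozenge:
  "cartesian ` vertices (Down (- int k) (2 * int k - 1)) =
     {(- 1 / 2, (2 * real k - 1) * (sqrt 3 / 2)), (1 / 2, (2 * real k - 1) * (sqrt 3 / 2)),
      (0, (2 * real k - 2) * (sqrt 3 / 2))}"
  "cartesian ` vertices (Up (- int k) (2 * int k - 1)) =
     {(- 1 / 2, (2 * real k - 1) * (sqrt 3 / 2)), (1 / 2, (2 * real k - 1) * (sqrt 3 / 2)),
      (0, 2 * real k * (sqrt 3 / 2))}"
  by (simp_all add: cartesian_def field_simps)

text \<open>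
  $S'_{a,b,c}$ is the region \<open>S_region a b c\<close> with the lozenge weights \<open>S'_weight a b c\<close>.
\<close>

definition S'_weight :: "nat \<Rightarrow> nat \<Rightarrow> nat \<Rightarrow> triangle set \<Rightarrow> real" where
  "S'_weight a b c L =
     (if \<exists>k\<in>{1..a + 1}. L = west_lozenge k \<and> west_lozenge k \<subseteq> S_region a b c then 1 / 2 else 1)"

definition M_S :: "nat \<Rightarrow> nat \<Rightarrow> nat \<Rightarrow> real" where
  "M_S a b c = matching_gf (\<lambda>_. 1) (S_region a b c)"

definition M_S' :: "nat \<Rightarrow> nat \<Rightarrow> nat \<Rightarrow> real" where
  "M_S' a b c = matching_gf (S'_weight a b c) (S_region a b c)"

lemma M_S_eq_card: "M_S a b c = real (card (lozenge_tilings (S_region a b c)))"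
  by (simp add: M_S_def matching_gf_def)

end

theory Submission
  imports Defs "Jordan_Normal_Form.Determinant"
begin

text \<open>
  The lozenges that have an edge parallel to $DE$ form non-intersecting lattice paths from the
  $a + 1$ zigzag edges parallel to $DE$ to the edges of $DE$ other than the dented one. By the
  Lindstroem--Gessel--Viennot principle both generating functions are determinants, with entries
  binomial coefficients $\binom{n}{u}$ for $S_{a,b,c}$ and $\binom{n-1}{u} + \frac12\binom{n-1}{u-1}
  = \frac{2n-u}{2n}\binom{n}{u}$ for $S'_{a,b,c}$, because the weight $1/2$ only affects a first step.
  Here $n$ depends on the row only and $2n - u$ on the column only, so the quotient of the determinants
  is the stated product. For $a = b + 1$ the last path is forced and contributes the factor $1$.
\<close>

section \<open>Determinants given by lists of columns\<close>

text \<open>Columns are functions on all naturals, so they can be listed, appended and exchanged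
  without tracking the dimension. Rows stand for starting points of paths, columns for end
  points.\<close>

definition cdet :: "(nat \<Rightarrow> real) list \<Rightarrow> real" where
  "cdet cs = det (mat (length cs) (length cs) (\<lambda>(i, j). (cs ! j) i))"

lemma cdet_Nil: "cdet [] = 1"
  by (simp add: cdet_def)

lemma cdet_leibniz:
  "cdet cs = (\<Sum>p | p permutes {0..<length cs}. signof p * (\<Prod>j<length cs. (cs ! j) (p j)))"
proof -
  have "signof p * (\<Prod>j<length cs. mat (length cs) (length cs) (\<lambda>(i, j). (cs ! j) i) $$ (p j, j))
      = signof p * (\<Prod>j<length cs. (cs ! j) (p j))" if "p permutes {0..<length cs}" for p :: "nat \<Rightarrow> nat"
    using permutes_in_image[OF that] by (intro arg_cong2[where f = "(*)"] prod.cong) auto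
  then show ?thesis
    unfolding cdet_def by (subst det_col[where n = "length cs"]) (auto intro!: sum.cong)
qed

lemma cdet_linear:
  assumes "\<And>i. i < length xs + length ys + 1 \<Longrightarrow> f i = u i + r * v i"
  shows "cdet (xs @ f # ys) = cdet (xs @ u # ys) + r * cdet (xs @ v # ys)"
proof -
  let ?n = "length xs + length ys + 1" and ?k = "length xs"
  have split: "(\<Prod>j<?n. ((xs @ w # ys) ! j) (p j)) = w (p ?k) * (\<Prod>j\<in>{..<?n} - {?k}. ((xs @ u # ys) ! j) (p j))"
    for w and p :: "nat \<Rightarrow> nat"
  proof -
    have "(xs @ w # ys) ! j = (xs @ u # ys) ! j" if "j \<noteq> ?k" for j
      using that by (simp add: nth_append nth_Cons')
    then have "(\<Prod>j\<in>{..<?n} - {?k}. ((xs @ w # ys) ! j) (p j)) = (\<Prod>j\<in>{..<?n} - {?k}. ((xs @ u # ys) ! j) (p j))"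
      by (intro prod.cong) auto
    then show ?thesis by (subst prod.remove[of _ ?k]) auto
  qed
  have len: "length (xs @ w # ys) = ?n" for w :: "nat \<Rightarrow> real" by simp
  have f: "f (p ?k) = u (p ?k) + r * v (p ?k)" if "p permutes {0..<?n}" for p
    using permutes_in_image[OF that, of ?k] by (intro assms) simp
  show ?thesis
    unfolding cdet_leibniz len split sum_distrib_left sum.distrib[symmetric]
    by (intro sum.cong refl) (simp add: f algebra_simps)
qed

lemma cdet_repeated:
  assumes "i < j" "j < length cs" "cs ! i = cs ! j"
  shows "cdet cs = 0"
  unfolding cdet_def using assms
  by (intro Determinant.det_identical_columns[where n = "length cs" and i = i and j = j])
    (auto intro!: eq_vecI)

lemma cdet_zero_col:
  assumes "f \<in> set cs" "\<And>i. i < length cs \<Longrightarrow> f i = 0"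
  shows "cdet cs = 0"
proof -
  obtain xs ys where cs: "cs = xs @ f # ys" using assms(1) by (auto simp: in_set_conv_decomp)
  \<comment> \<open>A zero column is the sum of two copies of itself, so by linearity the
    determinant equals its own double.\<close>
  have "cdet (xs @ f # ys) = cdet (xs @ f # ys) + 1 * cdet (xs @ f # ys)"
    using assms(2) cs by (intro cdet_linear) auto
  then show ?thesis using cs by simp
qed

lemma cdet_zero_row:
  assumes "n < length cs" "\<And>f. f \<in> set cs \<Longrightarrow> f n = 0"
  shows "cdet cs = 0"
proof -
  let ?A = "mat (length cs) (length cs) (\<lambda>(i, j). (cs ! j) i)"
  have "det ?A = (\<Sum>j<length cs. ?A $$ (n, j) * cofactor ?A n j)"
    using assms(1) by (intro laplace_expansion_row[where n = "length cs"]) auto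
  also have "\<dots> = 0" using assms by (intro sum.neutral) auto
  finally show ?thesis by (simp add: cdet_def)
qed

text \<open>Laplace expansion along the last row, whose only nonzero entry is the corner. It serves
  for a new path of length zero and for a last path that is forced.\<close>

lemma cdet_snoc:
  assumes "\<And>f. f \<in> set cs \<Longrightarrow> f (length cs) = 0" "u (length cs) = 1"
  shows "cdet (cs @ [u]) = cdet cs"
proof -
  let ?n = "length cs"
  let ?A = "mat (Suc ?n) (Suc ?n) (\<lambda>(i, j). ((cs @ [u]) ! j) i)"
  have "mat_delete ?A ?n ?n = mat ?n ?n (\<lambda>(i, j). (cs ! j) i)"
    by (intro eq_matI) (auto simp: mat_delete_def nth_append)
  then have del: "det (mat_delete ?A ?n ?n) = cdet cs" by (simp add: cdet_def)
  have "det ?A = (\<Sum>j<Suc ?n. ?A $$ (?n, j) * cofactor ?A ?n j)"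
    by (intro laplace_expansion_row[where n = "Suc ?n"]) auto
  also have "\<dots> = (\<Sum>j<?n. ?A $$ (?n, j) * cofactor ?A ?n j) + cdet cs"
    using assms(2) del by (simp add: nth_append cofactor_def flip: mult_2)
  also have "(\<Sum>j<?n. ?A $$ (?n, j) * cofactor ?A ?n j) = 0"
    using assms(1) by (intro sum.neutral) (auto simp: nth_append)
  finally show ?thesis by (simp add: cdet_def)
qed

text \<open>Every permutation in the Leibniz sum meets each row and each column once, so all terms
  carry the same factors.\<close>

lemma cdet_scale:
  assumes "\<And>x i. x \<in> set xs \<Longrightarrow> i < length xs \<Longrightarrow> f x i = r i * s x * g x i"
  shows "cdet (map f xs) = (\<Prod>i<length xs. r i) * (\<Prod>x\<leftarrow>xs. s x) * cdet (map g xs)"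
proof -
  let ?n = "length xs"
  have "signof p * (\<Prod>j<?n. (map f xs ! j) (p j)) =
      (\<Prod>i<?n. r i) * (\<Prod>x\<leftarrow>xs. s x) * (signof p * (\<Prod>j<?n. (map g xs ! j) (p j)))"
    if p: "p permutes {0..<?n}" for p
  proof -
    have "(\<Prod>j<?n. (map f xs ! j) (p j)) = (\<Prod>j<?n. r (p j) * s (xs ! j) * g (xs ! j) (p j))"
      using permutes_in_image[OF p] assms by (intro prod.cong) auto
    also have "\<dots> = (\<Prod>j<?n. r (p j)) * (\<Prod>j<?n. s (xs ! j)) * (\<Prod>j<?n. g (xs ! j) (p j))"
      by (simp add: prod.distrib)
    also have "(\<Prod>j<?n. r (p j)) = (\<Prod>i<?n. r i)"
      using prod.permute[OF p, of r] by (simp add: atLeast0LessThan)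
    also have "(\<Prod>j<?n. s (xs ! j)) = (\<Prod>x\<leftarrow>xs. s x)"
      by (simp add: prod.list_conv_set_nth atLeast0LessThan)
    finally show ?thesis by simp
  qed
  then show ?thesis unfolding cdet_leibniz sum_distrib_left by (intro sum.cong) auto
qed

section \<open>Removing lozenges from a region\<close>

lemma finite_lozenge_tilings:
  assumes "finite R"
  shows "finite (lozenge_tilings R)"
proof (rule finite_subset)
  show "lozenge_tilings R \<subseteq> Pow (Pow R)"
    by (auto simp: lozenge_tilings_def partition_on_def)
qed (use assms in simp)

lemma matching_gf_empty: "matching_gf w {} = 1"
proof -
  have "lozenge_tilings {} = {{}}"
    by (auto simp: lozenge_tilings_def partition_on_empty)
  then show ?thesis by (simp add: matching_gf_def)
qed

text \<open>Tilings are sorted by the lozenge \<open>{v, u}\<close> covering \<open>v\<close>;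
  deleting it is a bijection onto the tilings of the remaining region.\<close>

lemma matching_gf_expand:
  assumes R: "finite R" and v: "v \<in> R"
  shows "matching_gf w R =
    (\<Sum>u | u \<in> R \<and> u \<noteq> v \<and> lozenge {v, u}. w {v, u} * matching_gf w (R - {v, u}))"
proof -
  let ?N = "{u. u \<in> R \<and> u \<noteq> v \<and> lozenge {v, u}}"
  let ?F = "\<lambda>u. insert {v, u} ` lozenge_tilings (R - {v, u})"
  have notin: "A \<inter> {v, u} = {}" if "T \<in> lozenge_tilings (R - {v, u})" "A \<in> T" for T u A
    using that by (auto simp: lozenge_tilings_def partition_on_def)
  have dj: "disjnt {v, u} (\<Union>T)" if "T \<in> lozenge_tilings (R - {v, u})" for T u
    using notin[OF that] by (auto simp: disjnt_def)
  have tilings: "lozenge_tilings R = (\<Union>u\<in>?N. ?F u)"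
  proof (intro equalityI subsetI)
    fix T assume T: "T \<in> lozenge_tilings R"
    then have part: "partition_on R T" and loz: "\<And>L. L \<in> T \<Longrightarrow> lozenge L"
      by (auto simp: lozenge_tilings_def)
    obtain L where L: "L \<in> T" "v \<in> L" using part v by (auto simp: partition_on_def)
    obtain u where u: "L = {v, u}" "u \<noteq> v" using loz[OF L(1)] L(2) unfolding lozenge_def by (auto simp: doubleton_eq_iff)
    have "A \<inter> {v, u} = {}" if "A \<in> T - {L}" for A
      using that disjointD[OF partition_onD2[OF part], of A L] L u by auto
    then have "disjnt {v, u} (\<Union>(T - {L}))"
      unfolding disjnt_def by blast
    moreover have "partition_on R (insert {v, u} (T - {L}))"
      using part L u by (metis insert_Diff)
    ultimately have "partition_on (R - {v, u}) (T - {L})" "{v, u} \<subseteq> R"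
      using partition_on_insert by blast+
    then have "T - {L} \<in> lozenge_tilings (R - {v, u})" "u \<in> ?N"
      using loz L(1) u by (auto simp: lozenge_tilings_def)
    moreover have "T = insert {v, u} (T - {L})" using L u by auto
    ultimately show "T \<in> (\<Union>u\<in>?N. ?F u)" by blast
  next
    fix T assume "T \<in> (\<Union>u\<in>?N. ?F u)"
    then obtain u T' where u: "u \<in> ?N" and T': "T' \<in> lozenge_tilings (R - {v, u})"
      and T: "T = insert {v, u} T'" by blast
    show "T \<in> lozenge_tilings R"
      using u T' v partition_on_insert[OF dj[OF T'], of R]
      by (auto simp: T lozenge_tilings_def)
  qed
  have inner: "(\<Sum>T\<in>?F u. \<Prod>L\<in>T. w L) = w {v, u} * matching_gf w (R - {v, u})" if "u \<in> ?N" for u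
  proof -
    \<comment> \<open>As \<open>{v, u}\<close> is not yet a block, inserting it is injective and
      adds exactly one factor to the product.\<close>
    have notin': "{v, u} \<notin> T" if "T \<in> lozenge_tilings (R - {v, u})" for T
      using notin[OF that] by blast
    have "inj_on (insert {v, u}) (lozenge_tilings (R - {v, u}))"
      using notin' by (intro inj_onI) (metis Diff_insert_absorb)
    then have "(\<Sum>T\<in>?F u. \<Prod>L\<in>T. w L) = (\<Sum>T\<in>lozenge_tilings (R - {v, u}). \<Prod>L\<in>insert {v, u} T. w L)"
      by (simp add: sum.reindex)
    also have "\<dots> = (\<Sum>T\<in>lozenge_tilings (R - {v, u}). w {v, u} * (\<Prod>L\<in>T. w L))"
    proof (intro sum.cong refl prod.insert notin')
      fix T assume "T \<in> lozenge_tilings (R - {v, u})"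
      then have "T \<subseteq> Pow R" by (auto simp: lozenge_tilings_def partition_on_def)
      then show "finite T" using R finite_subset by blast
    qed
    finally show ?thesis by (simp add: matching_gf_def sum_distrib_left)
  qed
  have "matching_gf w R = (\<Sum>u\<in>?N. \<Sum>T\<in>?F u. \<Prod>L\<in>T. w L)"
    unfolding matching_gf_def tilings
  proof (rule sum.UNION_disjoint)
    show "\<forall>u\<in>?N. \<forall>u'\<in>?N. u \<noteq> u' \<longrightarrow> ?F u \<inter> ?F u' = {}"
    proof (intro ballI impI)
      fix u u' assume "u \<in> ?N" "u' \<in> ?N" "u \<noteq> u'"
      then have "{v, u} \<noteq> {v, u'}" by (auto simp: doubleton_eq_iff)
      then have "{v, u} \<notin> T" if "T \<in> ?F u'" for T
        using that notin[of _ u' "{v, u}"] by auto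
      then show "?F u \<inter> ?F u' = {}" by blast
    qed
  qed (use R in \<open>auto intro: finite_lozenge_tilings\<close>)
  then show ?thesis by (simp add: inner)
qed

text \<open>The pairs are removed one by one: uniqueness of the partner is inherited by subregions,
  so the other pairs stay forced.\<close>

lemma matching_gf_forced:
  assumes "finite K" "finite R" "v ` K \<subseteq> R" "u ` K \<subseteq> R" "inj_on v K" "inj_on u K" "v ` K \<inter> u ` K = {}"
    and "\<And>k x. k \<in> K \<Longrightarrow> x \<in> R \<Longrightarrow> x \<noteq> v k \<Longrightarrow> lozenge {v k, x} \<longleftrightarrow> x = u k"
    and "\<And>k. k \<in> K \<Longrightarrow> w {v k, u k} = 1"
  shows "matching_gf w R = matching_gf w (R - v ` K - u ` K)"
  using assms
proof (induction K arbitrary: R rule: finite_induct)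
  case empty
  then show ?case by simp
next
  case (insert k K)
  have N: "{x. x \<in> R \<and> x \<noteq> v k \<and> lozenge {v k, x}} = {u k}"
    using insert.prems by auto
  have "matching_gf w R = matching_gf w (R - {v k, u k})"
    using insert.prems by (subst matching_gf_expand[where v = "v k"]) (auto simp: N)
  also have "\<dots> = matching_gf w (R - {v k, u k} - v ` K - u ` K)"
  proof (rule insert.IH)
    have "v k \<notin> v ` K" "u k \<notin> u ` K"
      using insert.prems insert.hyps by auto
    then show "v ` K \<subseteq> R - {v k, u k}" "u ` K \<subseteq> R - {v k, u k}"
      using insert.prems(2,3,6) unfolding image_insert by blast+
  qed (use insert.prems in auto)
  also have "R - {v k, u k} - v ` K - u ` K = R - v ` insert k K - u ` insert k K"
    by auto
  finally show ?case .
qed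

section \<open>Triangles in strips parallel to \<open>DE\<close>\<close>

text \<open>
  Lattice lines parallel to $DE$ are $x + k = d$ in lattice coordinates. Both triangles below lie between
  the lines $d$ and $d + 1$; \<open>up_at d k\<close> has an edge on line $d + 1$ and \<open>down_at d k\<close>
  on line $d$, each with lower end point at height $k$.
\<close>

definition up_at :: "int \<Rightarrow> int \<Rightarrow> triangle" where
  "up_at d k = Up (d - k) k"

definition down_at :: "int \<Rightarrow> int \<Rightarrow> triangle" where
  "down_at d k = Down (d - k - 1) (k + 1)"

lemma triangle_at_simps [simp]:
  "up_at d k = up_at e l \<longleftrightarrow> d = e \<and> k = l"
  "down_at d k = down_at e l \<longleftrightarrow> d = e \<and> k = l"
  "up_at d k \<noteq> down_at e l"
  "down_at e l \<noteq> up_at d k"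
  by (auto simp: up_at_def down_at_def)

lemma triangle_at_cases:
  obtains d k where "t = up_at d k" | d k where "t = down_at d k"
proof (cases t)
  case (Up i k)
  then have "t = up_at (i + k) k" by (simp add: up_at_def)
  then show ?thesis using that by blast
next
  case (Down i k)
  then have "t = down_at (i + k) (k - 1)" by (simp add: down_at_def)
  then show ?thesis using that by blast
qed

lemma lozenge_pair_iff:
  assumes "s \<noteq> t"
  shows "lozenge {s, t} \<longleftrightarrow> card (vertices s \<inter> vertices t) = 2"
  using assms unfolding lozenge_def by (auto simp: doubleton_eq_iff Int_commute)

text \<open>Inequalities in place of vertex lists turn adjacency into linear integer
  arithmetic.\<close>

lemma in_vertices_iff:
  "(x, y) \<in> vertices (up_at d k) \<longleftrightarrow> d - k \<le> x \<and> k \<le> y \<and> x + y \<le> d + 1"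
  "(x, y) \<in> vertices (down_at d k) \<longleftrightarrow> x \<le> d - k \<and> y \<le> k + 1 \<and> d \<le> x + y"
  unfolding up_at_def down_at_def vertices.simps insert_iff prod.inject empty_iff by presburger+

lemma lozengeE:
  assumes "lozenge {s, t}"
  obtains x y x' y' where "s \<noteq> t" "(x, y) \<noteq> (x', y')"
    "(x, y) \<in> vertices s" "(x, y) \<in> vertices t" "(x', y') \<in> vertices s" "(x', y') \<in> vertices t"
proof -
  have "s \<noteq> t" using assms by (auto simp: lozenge_def doubleton_eq_iff)
  moreover then obtain X Y where "X \<noteq> Y" "vertices s \<inter> vertices t = {X, Y}"
    using assms unfolding lozenge_pair_iff[OF \<open>s \<noteq> t\<close>] card_2_iff by blast
  ultimately show ?thesis using that[of "fst X" "snd X" "fst Y" "snd Y"] by auto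
qed

lemma no_lozenge_up_up: "\<not> lozenge {up_at d k, up_at e l}"
proof
  assume "lozenge {up_at d k, up_at e l}"
  then show False
    by (rule lozengeE) (unfold in_vertices_iff prod.inject triangle_at_simps, smt (verit))
qed

lemma no_lozenge_down_down: "\<not> lozenge {down_at d k, down_at e l}"
proof
  assume "lozenge {down_at d k, down_at e l}"
  then show False
    by (rule lozengeE) (unfold in_vertices_iff prod.inject triangle_at_simps, smt (verit))
qed

text \<open>The shared edge is parallel to \<open>CD\<close>, horizontal, or parallel to
  \<open>DE\<close>. The first two kinds stay in a strip and are the path steps; the third straddles
  a line and belongs to no path.\<close>

lemma lozenge_up_down_iff:
  "lozenge {up_at d k, down_at e l} \<longleftrightarrow>
    e = d \<and> l = k \<or> e = d \<and> l = k - 1 \<or> e = d + 1 \<and> l = k" (is "?l \<longleftrightarrow> ?r")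
proof
  assume ?l
  then show ?r by (rule lozengeE) (unfold in_vertices_iff prod.inject, smt (verit))
next
  assume ?r
  moreover have two: "card (vertices (up_at d k) \<inter> vertices (down_at e l)) = 2"
    if "X \<noteq> Y" "\<And>x y. (x, y) \<in> vertices (up_at d k) \<and> (x, y) \<in> vertices (down_at e l) \<longleftrightarrow>
      (x, y) = X \<or> (x, y) = Y" for X Y
  proof -
    have "vertices (up_at d k) \<inter> vertices (down_at e l) = {X, Y}" using that(2) by auto
    then show ?thesis using \<open>X \<noteq> Y\<close> by simp
  qed
  ultimately have "card (vertices (up_at d k) \<inter> vertices (down_at e l)) = 2"
  proof (elim disjE conjE)
    assume "e = d" "l = k"
    then show ?thesis
      by (intro two[of "(d - k, k)" "(d - k, k + 1)"]) (simp, unfold in_vertices_iff prod.inject, presburger)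
  next
    assume "e = d" "l = k - 1"
    then show ?thesis
      by (intro two[of "(d - k, k)" "(d - k + 1, k)"]) (simp, unfold in_vertices_iff prod.inject, presburger)
  next
    assume "e = d + 1" "l = k"
    then show ?thesis
      by (intro two[of "(d - k + 1, k)" "(d - k, k + 1)"]) (simp, unfold in_vertices_iff prod.inject, presburger)
  qed
  then show ?l by (simp add: lozenge_pair_iff)
qed

lemma lozenge_down_up_iff:
  "lozenge {down_at e l, up_at d k} \<longleftrightarrow>
    e = d \<and> l = k \<or> e = d \<and> l = k - 1 \<or> e = d + 1 \<and> l = k"
  by (subst insert_commute) (rule lozenge_up_down_iff)

text \<open>The lower bounds on \<open>k\<close> come from \<open>BC\<close> and \<open>CD\<close>.
  For \<open>a \<le> b + 1\<close> the two minima merge the bounds of the zigzag, \<open>FA\<close>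
  and \<open>EF\<close> into one.\<close>

definition has_up :: "nat \<Rightarrow> nat \<Rightarrow> nat \<Rightarrow> int \<Rightarrow> int \<Rightarrow> bool" where
  "has_up a b c d k \<longleftrightarrow> 0 \<le> d \<and> d \<le> int b + int c \<and> 0 \<le> k \<and> d - int c \<le> k \<and>
    k \<le> 1 + min d (int a) + min d (int b)"

definition has_down :: "nat \<Rightarrow> nat \<Rightarrow> nat \<Rightarrow> int \<Rightarrow> int \<Rightarrow> bool" where
  "has_down a b c d k \<longleftrightarrow> 0 \<le> d \<and> d \<le> int b + int c \<and> 0 \<le> k \<and> d - int c - 1 \<le> k \<and>
    k \<le> min d (int a) + min d (int b + 1)"

text \<open>At height \<open>y\<close> the zigzag has first coordinate \<open>-y/2\<close> rounded
  down; by integrality one inequality covers both parities.\<close>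

lemma east_of_zigzag_iff:
  "east_of_zigzag a (x, y) \<longleftrightarrow> (0 \<le> y \<and> y \<le> 2 * int a + 1 \<longrightarrow> 0 \<le> 2 * x + y + 1)"
proof -
  have z: "fst (zigzag j) \<le> x \<longleftrightarrow> 0 \<le> 2 * x + int j + 1" for j
    using zigzag_even_odd[of "j div 2"] by (cases "even j") (auto elim!: evenE oddE)
  show ?thesis
  proof
    assume east: "east_of_zigzag a (x, y)"
    show "0 \<le> y \<and> y \<le> 2 * int a + 1 \<longrightarrow> 0 \<le> 2 * x + y + 1"
    proof
      assume "0 \<le> y \<and> y \<le> 2 * int a + 1"
      then have "nat y \<le> 2 * a + 1" "y = int (nat y)" by auto
      then show "0 \<le> 2 * x + y + 1"
        using east z[of "nat y"] unfolding east_of_zigzag_def by auto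
    qed
  qed (auto simp: east_of_zigzag_def z)
qed

text \<open>If \<open>b = 0\<close> or \<open>c = 0\<close>, the condition of the degenerate side
  \<open>CD\<close> or \<open>EF\<close> is void, but its inequality then follows from those of the
  two adjacent sides.\<close>

lemma in_hexagon_iff:
  "in_hexagon a b c (x, y) \<longleftrightarrow> 0 \<le> y \<and> x \<le> int c + 1 \<and> x + y \<le> int b + int c + 1 \<and>
    y \<le> int a + int b + 2 \<and> - int a - 1 \<le> x \<and> 0 \<le> x + y"
proof -
  have "weakly_left (vB a b c) (vC a b c) (x, y) \<longleftrightarrow> 0 \<le> (int c + 1) * y"
    "weakly_left (vC a b c) (vD a b c) (x, y) \<longleftrightarrow> 0 \<le> int b * (int c + 1 - x)"
    "weakly_left (vD a b c) (vE a b c) (x, y) \<longleftrightarrow> 0 \<le> (int a + 2) * (int b + int c + 1 - x - y)"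
    "weakly_left (vE a b c) (vF a b c) (x, y) \<longleftrightarrow> 0 \<le> int c * (int a + int b + 2 - y)"
    "weakly_left (vF a b c) (vA a b c) (x, y) \<longleftrightarrow> 0 \<le> (int b + 1) * (x + int a + 1)"
    "weakly_left (vA a b c) (vB a b c) (x, y) \<longleftrightarrow> 0 \<le> (int a + 1) * (x + y)"
    by (simp_all add: weakly_left_def vA_def vB_def vC_def vD_def vE_def vF_def algebra_simps)
  then show ?thesis
    unfolding in_hexagon_def by (cases "b = 0"; cases "c = 0") (auto simp: zero_le_mult_iff)
qed

lemma sum_min_ge_iff:
  fixes d x y z :: int
  shows "z \<le> min d x + min d y \<longleftrightarrow> z \<le> 2 * d \<and> z \<le> d + x \<and> z \<le> d + y \<and> z \<le> x + y"
  by linarith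

lemma up_at_in_polygon_iff:
  assumes "a \<le> b + 1"
  shows "up_at d k \<in> polygon_region a b c \<longleftrightarrow> has_up a b c d k"
proof -
  have min: "k \<le> 1 + min d (int a) + min d (int b) \<longleftrightarrow>
      k \<le> 2 * d + 1 \<and> k \<le> d + int a + 1 \<and> k \<le> d + int b + 1 \<and> k \<le> int a + int b + 1"
    using sum_min_ge_iff[of "k - 1" d "int a" "int b"] by linarith
  have "int a \<le> int b + 1" using assms by linarith
  then show ?thesis
    unfolding polygon_region_def up_at_def has_up_def min mem_Collect_eq vertices.simps ball_simps
      in_hexagon_iff east_of_zigzag_iff
    by (smt (verit) of_nat_0_le_iff ball_empty)
qed

lemma down_at_in_polygon_iff:
  assumes "a \<le> b + 1"
  shows "down_at d k \<in> polygon_region a b c \<longleftrightarrow> has_down a b c d k"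
proof -
  have min: "k \<le> min d (int a) + min d (int b + 1) \<longleftrightarrow>
      k \<le> 2 * d \<and> k \<le> d + int a \<and> k \<le> d + int b + 1 \<and> k \<le> int a + int b + 1"
    using sum_min_ge_iff[of k d "int a" "int b + 1"] by linarith
  have "int a \<le> int b + 1" using assms by linarith
  then show ?thesis
    unfolding polygon_region_def down_at_def has_down_def min mem_Collect_eq vertices.simps ball_simps
      in_hexagon_iff east_of_zigzag_iff
    by (smt (verit) of_nat_0_le_iff ball_empty)
qed

section \<open>Binomial coefficients and weighted path counts\<close>

text \<open>With an integer lower index, Pascal's rule needs no side condition and height
  differences may be negative.\<close>

definition zbinom :: "nat \<Rightarrow> int \<Rightarrow> real" where
  "zbinom n k = (if k < 0 then 0 else real (n choose nat k))"

lemma zbinom_Suc: "zbinom (Suc n) k = zbinom n k + zbinom n (k - 1)"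
proof (cases "k \<le> 0")
  case False
  then obtain j where "k = int (Suc j)" by (metis gr0_implies_Suc linorder_not_le zero_less_imp_eq_int)
  then show ?thesis by (simp add: zbinom_def nat_add_distrib)
qed (auto simp: zbinom_def)

lemma zbinom_0_left: "zbinom 0 k = (if k = 0 then 1 else 0)"
  by (simp add: zbinom_def)

lemma zbinom_eq_0: "k < 0 \<or> int n < k \<Longrightarrow> zbinom n k = 0"
  by (auto simp: zbinom_def)

lemma zbinom_absorb: "of_int k * zbinom (Suc n) k = real (Suc n) * zbinom n (k - 1)"
proof (cases "k \<le> 0")
  case False
  then obtain j where "k = int (Suc j)" by (metis gr0_implies_Suc linorder_not_le zero_less_imp_eq_int)
  moreover have "real (Suc j) * real (Suc n choose Suc j) = real (Suc n) * real (n choose j)"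
    by (metis Suc_times_binomial_eq mult.commute of_nat_mult)
  ultimately show ?thesis by (simp add: zbinom_def nat_add_distrib)
qed (auto simp: zbinom_def)

text \<open>
  The weighted number of lattice paths from line $i$, height $2i$, to line $d$, height $p$. Every step keeps the height or raises it by one; a first step of the latter kind has weight $x$.
\<close>

definition path_weight :: "real \<Rightarrow> nat \<Rightarrow> int \<Rightarrow> nat \<Rightarrow> real" where
  "path_weight x d p i =
     (if d < i then 0
      else if d = i then if p = 2 * int i then 1 else 0
      else zbinom (d - i - 1) (p - 2 * int i) + x * zbinom (d - i - 1) (p - 2 * int i - 1))"

lemma path_weight_eq_0: "p < 2 * int i \<or> int i + int d < p \<Longrightarrow> path_weight x d p i = 0"
  by (auto simp: path_weight_def zbinom_eq_0)

text \<open>Pascal's rule, by the last step. The weight \<open>x\<close> belongs to a rise from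
  height \<open>2 * d\<close> on line \<open>d\<close>, which only the path starting there can make:
  one from an earlier line \<open>i\<close> has height at most \<open>i + d < 2 * d\<close>.\<close>

lemma path_weight_Suc:
  assumes "i \<le> d"
  shows "path_weight x (Suc d) q i =
    path_weight x d q i + (if q - 1 = 2 * int d then x else 1) * path_weight x d (q - 1) i"
proof (cases "i = d")
  case True
  then show ?thesis by (auto simp: path_weight_def zbinom_0_left)
next
  case False
  then obtain n where n: "d = Suc (i + n)" using assms less_imp_Suc_add[of i d] by auto
  have "path_weight x d (q - 1) i = 0" if "q - 1 = 2 * int d"
    using that assms False by (intro path_weight_eq_0) auto
  then have "(if q - 1 = 2 * int d then x else 1) * path_weight x d (q - 1) i = path_weight x d (q - 1) i"
    by auto
  then show ?thesis
    by (simp add: path_weight_def n zbinom_Suc algebra_simps)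
qed

section \<open>Peeling off the strips\<close>

text \<open>One weight serves both regions, with \<open>x = 1\<close> and \<open>x = 1/2\<close>.
  Containment in the region is left out because the blocks of a tiling satisfy it anyway.\<close>

definition lozenge_weight :: "nat \<Rightarrow> real \<Rightarrow> triangle set \<Rightarrow> real" where
  "lozenge_weight a x L = (if \<exists>k\<in>{1..a + 1}. L = west_lozenge k then x else 1)"

lemma west_lozenge_eq:
  "west_lozenge k = {down_at (int k - 1) (2 * int k - 2), up_at (int k - 1) (2 * int k - 1)}"
  by (simp add: west_lozenge_def up_at_def down_at_def)

lemma lozenge_weight_simps:
  "lozenge_weight a x {up_at d k, down_at d k} = 1"
  "lozenge_weight a x {down_at (d + 1) k, up_at d k} = 1"
  "lozenge_weight a x {up_at d k, down_at d (k - 1)} =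
     (if 0 \<le> d \<and> d \<le> int a \<and> k - 1 = 2 * d then x else 1)"
proof -
  show "lozenge_weight a x {up_at d k, down_at d k} = 1"
    "lozenge_weight a x {down_at (d + 1) k, up_at d k} = 1"
    by (auto simp: lozenge_weight_def west_lozenge_eq doubleton_eq_iff)
  have "(\<exists>j\<in>{1..a + 1}. {up_at d k, down_at d (k - 1)} = west_lozenge j) \<longleftrightarrow>
      0 \<le> d \<and> d \<le> int a \<and> k - 1 = 2 * d"
  proof
    assume "0 \<le> d \<and> d \<le> int a \<and> k - 1 = 2 * d"
    then show "\<exists>j\<in>{1..a + 1}. {up_at d k, down_at d (k - 1)} = west_lozenge j"
      by (intro bexI[of _ "nat d + 1"]) (auto simp: west_lozenge_eq doubleton_eq_iff)
  qed (auto simp: west_lozenge_eq doubleton_eq_iff)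
  then show "lozenge_weight a x {up_at d k, down_at d (k - 1)} =
     (if 0 \<le> d \<and> d \<le> int a \<and> k - 1 = 2 * d then x else 1)"
    by (simp add: lozenge_weight_def)
qed

text \<open>
  The part of the polygon up to strip $d$, where in strip $d$ only the upward triangles at $Q$ are kept and
  the downward triangles at $P$ are already covered.
\<close>

definition partial_region :: "nat \<Rightarrow> nat \<Rightarrow> nat \<Rightarrow> int \<Rightarrow> int set \<Rightarrow> int set \<Rightarrow> triangle set" where
  "partial_region a b c d Q P =
     {up_at e k | e k. has_up a b c e k \<and> (e < d \<or> e = d \<and> k \<in> Q)} \<union>
     {down_at e k | e k. has_down a b c e k \<and> (e < d \<or> e = d \<and> k \<notin> P)}"

lemma in_partial_region:
  "up_at e k \<in> partial_region a b c d Q P \<longleftrightarrow> has_up a b c e k \<and> (e < d \<or> e = d \<and> k \<in> Q)"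
  "down_at e k \<in> partial_region a b c d Q P \<longleftrightarrow> has_down a b c e k \<and> (e < d \<or> e = d \<and> k \<notin> P)"
  by (auto simp: partial_region_def)

lemma triangle_set_eqI:
  assumes "\<And>d k. up_at d k \<in> A \<longleftrightarrow> up_at d k \<in> B" "\<And>d k. down_at d k \<in> A \<longleftrightarrow> down_at d k \<in> B"
  shows "A = B"
proof (rule Set.set_eqI)
  show "t \<in> A \<longleftrightarrow> t \<in> B" for t by (cases t rule: triangle_at_cases) (auto simp: assms)
qed

lemma finite_partial_region: "finite (partial_region a b c d Q P)"
proof (rule finite_subset)
  let ?I = "{0..int b + int c} \<times> {0..1 + int a + int b}"
  show "partial_region a b c d Q P \<subseteq> (\<lambda>(e, k). up_at e k) ` ?I \<union> (\<lambda>(e, k). down_at e k) ` ?I"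
    by (auto simp: partial_region_def has_up_def has_down_def)
qed auto

text \<open>Triangles facing each other across line \<open>d\<close> occur together, except that for
  \<open>d \<le> a\<close> the downward one at height \<open>2 * d\<close> has its edge on the
  zigzag: a new path starts there.\<close>

lemma has_up_iff_has_down:
  assumes "a \<le> b + 1" "0 \<le> d" "d \<le> int b + int c"
  shows "has_up a b c (d - 1) k \<longleftrightarrow> has_down a b c d k \<and> (d \<le> int a \<longrightarrow> k \<noteq> 2 * d)"
proof -
  have "has_up a b c (d - 1) k \<longleftrightarrow> 1 \<le> d \<and> 0 \<le> k \<and> d - int c - 1 \<le> k \<and> k \<le> 2 * d - 1 \<and>
      k \<le> d + int a \<and> k \<le> d + int b \<and> k \<le> int a + int b + 1"
    using assms(3) sum_min_ge_iff[of "k - 1" "d - 1" "int a" "int b"] unfolding has_up_def by auto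
  moreover have "has_down a b c d k \<longleftrightarrow> 0 \<le> k \<and> d - int c - 1 \<le> k \<and> k \<le> 2 * d \<and>
      k \<le> d + int a \<and> k \<le> d + int b + 1 \<and> k \<le> int a + int b + 1"
    using assms sum_min_ge_iff[of k d "int a" "int b + 1"] unfolding has_down_def by auto
  moreover have "int a \<le> int b + 1" using assms(1) by linarith
  ultimately show ?thesis using assms(2) by (cases "d \<le> int a") auto
qed

text \<open>With no upward triangle left in strip \<open>d\<close>, each uncovered downward one must
  be joined across line \<open>d\<close>. What stays in strip \<open>d - 1\<close> are the upward
  triangles at heights in \<open>P\<close>, where paths cross the line.\<close>

lemma matching_gf_forced_strip:
  assumes "a \<le> b + 1" "0 \<le> d" "d \<le> int b + int c" "d \<le> int a \<Longrightarrow> 2 * d \<in> P"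
  shows "matching_gf (lozenge_weight a x) (partial_region a b c d {} P) =
    matching_gf (lozenge_weight a x) (partial_region a b c (d - 1) P {})"
proof -
  let ?R = "partial_region a b c d {} P"
  define K where "K = {k. has_down a b c d k \<and> k \<notin> P}"
  have up: "has_up a b c (d - 1) k" if "k \<in> K" for k
    using that assms has_up_iff_has_down[OF assms(1-3)] by (auto simp: K_def)
  have "finite K"
    by (rule finite_subset[of _ "{0..int a + int b + 1}"]) (auto simp: K_def has_down_def)
  then have "matching_gf (lozenge_weight a x) ?R =
      matching_gf (lozenge_weight a x) (?R - down_at d ` K - up_at (d - 1) ` K)"
  proof (rule matching_gf_forced)
    fix k t assume k: "k \<in> K" and t: "t \<in> ?R" "t \<noteq> down_at d k"
    show "lozenge {down_at d k, t} \<longleftrightarrow> t = up_at (d - 1) k"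
      using t by (cases t rule: triangle_at_cases)
        (auto simp: lozenge_down_up_iff no_lozenge_down_down in_partial_region)
  next
    show "lozenge_weight a x {down_at d k, up_at (d - 1) k} = 1" for k
      using lozenge_weight_simps(2)[of a x "d - 1" k] by simp
  qed (auto simp: finite_partial_region in_partial_region K_def inj_on_def up[unfolded K_def])
  also have "?R - down_at d ` K - up_at (d - 1) ` K = partial_region a b c (d - 1) P {}"
  proof (rule triangle_set_eqI)
    fix e k
    have P: "has_up a b c (d - 1) k \<Longrightarrow> k \<in> P \<longleftrightarrow> k \<notin> K"
      using has_up_iff_has_down[OF assms(1-3)] by (simp add: K_def)
    have "up_at e k \<in> ?R - down_at d ` K - up_at (d - 1) ` K \<longleftrightarrow>
        has_up a b c e k \<and> e < d \<and> (e = d - 1 \<longrightarrow> k \<notin> K)"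
      by (auto simp: in_partial_region)
    also have "\<dots> \<longleftrightarrow> has_up a b c e k \<and> (e < d - 1 \<or> e = d - 1 \<and> k \<in> P)"
      using P by (cases "e = d - 1") auto
    finally show "up_at e k \<in> ?R - down_at d ` K - up_at (d - 1) ` K \<longleftrightarrow>
        up_at e k \<in> partial_region a b c (d - 1) P {}"
      by (simp only: in_partial_region)
    have "down_at e k \<in> ?R - down_at d ` K - up_at (d - 1) ` K \<longleftrightarrow> has_down a b c e k \<and> e < d"
      by (auto simp: in_partial_region K_def)
    then show "down_at e k \<in> ?R - down_at d ` K - up_at (d - 1) ` K \<longleftrightarrow>
        down_at e k \<in> partial_region a b c (d - 1) P {}"
      by (simp add: in_partial_region) linarith
  qed
  finally show ?thesis .
qed

text \<open>The downward triangle at the zigzag has no neighbour left, neither in its strip nor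
  across line \<open>d\<close>.\<close>

lemma matching_gf_blocked_strip:
  assumes "a \<le> b + 1" "0 \<le> d" "d \<le> int b + int c" "d \<le> int a" "2 * d \<notin> P"
  shows "matching_gf w (partial_region a b c d {} P) = 0"
proof -
  let ?R = "partial_region a b c d {} P"
  have empty: "{t. t \<in> ?R \<and> t \<noteq> down_at d (2 * d) \<and> lozenge {down_at d (2 * d), t}} = {}"
  proof -
    have "\<not> lozenge {down_at d (2 * d), t}" if "t \<in> ?R" for t
      using that has_up_iff_has_down[OF assms(1-3), of "2 * d"] assms(4)
      by (cases t rule: triangle_at_cases)
        (auto simp: lozenge_down_up_iff no_lozenge_down_down in_partial_region)
    then show ?thesis by blast
  qed
  have "down_at d (2 * d) \<in> ?R"
    using assms by (auto simp: in_partial_region has_down_def)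
  from matching_gf_expand[OF finite_partial_region this, of w] show ?thesis
    by (simp only: empty sum.empty)
qed

text \<open>The third neighbour of \<open>up_at d q\<close> lies in strip \<open>d + 1\<close>,
  outside the region, so only the two path steps remain.\<close>

lemma matching_gf_strip_step:
  assumes "has_up a b c d q" "q \<notin> Q"
  shows "matching_gf (lozenge_weight a x) (partial_region a b c d (insert q Q) P) =
    (\<Sum>p\<in>{p. (p = q \<or> p = q - 1) \<and> has_down a b c d p \<and> p \<notin> P}.
       (if p = q - 1 \<and> p = 2 * d then x else 1) *
       matching_gf (lozenge_weight a x) (partial_region a b c d Q (insert p P)))"
proof -
  let ?R = "partial_region a b c d (insert q Q) P"
  let ?N = "{p. (p = q \<or> p = q - 1) \<and> has_down a b c d p \<and> p \<notin> P}"
  have "t \<in> ?R \<and> t \<noteq> up_at d q \<and> lozenge {up_at d q, t} \<longleftrightarrow> t \<in> down_at d ` ?N" for t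
    by (cases t rule: triangle_at_cases)
      (auto simp: lozenge_up_down_iff no_lozenge_up_up in_partial_region)
  then have N: "{t. t \<in> ?R \<and> t \<noteq> up_at d q \<and> lozenge {up_at d q, t}} = down_at d ` ?N"
    by blast
  have R: "?R - {up_at d q, down_at d p} = partial_region a b c d Q (insert p P)" for p
    using assms by (intro triangle_set_eqI) (auto simp: in_partial_region)
  \<comment> \<open>For \<open>q - 1 = 2 * d\<close> the height bound on \<open>q\<close> forces
    \<open>d \<le> a\<close>, so the vertical lozenge is a weighted one.\<close>
  have "0 \<le> d" "q - 1 = 2 * d \<Longrightarrow> d \<le> int a"
    using assms(1) by (auto simp: has_up_def)
  then have w: "lozenge_weight a x {up_at d q, down_at d p} = (if p = q - 1 \<and> p = 2 * d then x else 1)"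
    if "p = q \<or> p = q - 1" for p
    using that by (auto simp: lozenge_weight_simps)
  have "matching_gf (lozenge_weight a x) ?R =
      (\<Sum>t\<in>down_at d ` ?N. lozenge_weight a x {up_at d q, t} *
         matching_gf (lozenge_weight a x) (?R - {up_at d q, t}))"
    using assms by (subst matching_gf_expand[OF finite_partial_region, of "up_at d q"])
      (auto simp: N in_partial_region)
  also have "\<dots> = (\<Sum>p\<in>?N. lozenge_weight a x {up_at d q, down_at d p} *
         matching_gf (lozenge_weight a x) (?R - {up_at d q, down_at d p}))"
    by (simp add: sum.reindex inj_on_def)
  also have "\<dots> = (\<Sum>p\<in>?N. (if p = q - 1 \<and> p = 2 * d then x else 1) *
       matching_gf (lozenge_weight a x) (partial_region a b c d Q (insert p P)))"
    by (intro sum.cong refl) (auto simp: R w)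
  finally show ?thesis .
qed

text \<open>
  Covering the upward triangles of a strip from top to bottom replaces the columns of the determinant one by
  one. The terms without a tiling have a repeated column or a zero column.
\<close>

lemma matching_gf_strip_eq_cdet:
  assumes d: "d \<le> b + c"
    and base: "\<And>ps. sorted_wrt (<) ps \<Longrightarrow> length ps = min (d + 1) (a + 1) \<Longrightarrow>
      (\<forall>p\<in>set ps. has_down a b c (int d) p) \<Longrightarrow>
      matching_gf (lozenge_weight a x) (partial_region a b c (int d) {} (set ps)) =
        cdet (map (path_weight x d) ps)"
    and qs: "sorted_wrt (<) qs" "\<forall>q\<in>set qs. has_up a b c (int d) q"
    and ps: "sorted_wrt (<) ps" "\<forall>p\<in>set ps. has_down a b c (int d) p"
    and le: "\<forall>q\<in>set qs. \<forall>p\<in>set ps. q \<le> p"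
    and len: "length qs + length ps = min (d + 1) (a + 1)"
  shows "matching_gf (lozenge_weight a x) (partial_region a b c (int d) (set qs) (set ps)) =
    cdet (map (path_weight x (Suc d)) qs @ map (path_weight x d) ps)"
  using qs ps le len
proof (induction qs arbitrary: ps rule: rev_induct)
  case Nil
  then show ?case using base by simp
next
  case (snoc q qs)
  have q: "has_up a b c (int d) q" and q_gr: "\<forall>q'\<in>set qs. q' < q" and q_le: "\<forall>p\<in>set ps. q \<le> p"
    using snoc.prems by (auto simp: sorted_wrt_append)
  let ?gf = "\<lambda>p. matching_gf (lozenge_weight a x) (partial_region a b c (int d) (set qs) (insert p (set ps)))"
  let ?det = "\<lambda>f. cdet (map (path_weight x (Suc d)) qs @ f # map (path_weight x d) ps)"
  have column: "(if has_down a b c (int d) p \<and> p \<notin> set ps then ?gf p else 0) = ?det (path_weight x d p)"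
    if p: "p = q \<or> p = q - 1" for p
  proof -
    consider "p \<in> set ps" | "\<not> has_down a b c (int d) p" | "has_down a b c (int d) p" "p \<notin> set ps"
      by blast
    then show ?thesis
    proof cases
      case 1
      then obtain j where "j < length ps" "ps ! j = p" by (auto simp: in_set_conv_nth)
      \<comment> \<open>Two paths would meet at \<open>p\<close>, and the determinant has a repeated
        column.\<close>
      then have "?det (path_weight x d p) = 0"
        by (intro cdet_repeated[where i = "length qs" and j = "length qs + 1 + j"])
          (auto simp: nth_append)
      then show ?thesis using 1 by simp
    next
      case 2
      have "?det (path_weight x d p) = 0"
      proof (rule cdet_zero_col)
        fix i assume "i < length (map (path_weight x (Suc d)) qs @ path_weight x d p # map (path_weight x d) ps)"
        then have i: "i \<le> d" "i \<le> a" using snoc.prems by auto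
        \<comment> \<open>The only failing heights are \<open>-1\<close> and the one just past the
          western boundary; no path from a row \<open>i \<le> min d a\<close> gets there.\<close>
        have "p < 0 \<or> int d + min (int d) (int a) < p"
          using 2 p q d unfolding has_up_def has_down_def by linarith
        then show "path_weight x d p i = 0"
          using i by (intro path_weight_eq_0) linarith
      qed simp
      then show ?thesis using 2 by simp
    next
      case 3
      \<comment> \<open>Here \<open>p \<le> q \<le> p'\<close>, with equality throughout excluded by
        \<open>p\<close> not being in \<open>ps\<close>; so \<open>p # ps\<close> is again
        increasing.\<close>
      have "q \<noteq> p' \<or> p \<noteq> q" if "p' \<in> set ps" for p' using 3 that by auto
      then have "p < p'" if "p' \<in> set ps" for p' using p q_le that by force
      then have "?gf p = cdet (map (path_weight x (Suc d)) qs @ map (path_weight x d) (p # ps))"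
        using snoc.prems 3 p q_gr q_le
        by (subst snoc.IH[of "p # ps", symmetric]) (auto simp: sorted_wrt_append)
      then show ?thesis using 3 by simp
    qed
  qed
  let ?r = "if q - 1 = 2 * int d then x else 1"
  have "matching_gf (lozenge_weight a x) (partial_region a b c (int d) (set (qs @ [q])) (set ps)) =
    (\<Sum>p\<in>{p. (p = q \<or> p = q - 1) \<and> has_down a b c (int d) p \<and> p \<notin> set ps}.
       (if p = q - 1 \<and> p = 2 * int d then x else 1) * ?gf p)"
    using matching_gf_strip_step[OF q, of "set qs" x "set ps"] q_gr by auto
  also have "\<dots> = (\<Sum>p\<in>{q, q - 1}. (if p = q - 1 \<and> p = 2 * int d then x else 1) *
      (if has_down a b c (int d) p \<and> p \<notin> set ps then ?gf p else 0))"
    by (intro sum.mono_neutral_cong_left) auto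
  also have "\<dots> = (\<Sum>p\<in>{q, q - 1}. (if p = q - 1 \<and> p = 2 * int d then x else 1) *
      ?det (path_weight x d p))"
    by (intro sum.cong refl arg_cong2[where f = "(*)"] column) auto
  also have "\<dots> = ?det (path_weight x d q) + ?r * ?det (path_weight x d (q - 1))"
    by simp
  also have "\<dots> = ?det (path_weight x (Suc d) q)"
    using snoc.prems by (intro cdet_linear[symmetric] path_weight_Suc) auto
  finally show ?case by simp
qed

text \<open>Induction over the lines. Strip \<open>d\<close> moves the end points to line
  \<open>d\<close>; crossing this line is forced, and for \<open>d \<le> a\<close> the new path
  accounts for row \<open>d\<close>.\<close>

lemma matching_gf_eq_cdet:
  assumes "a \<le> b + 1" "d \<le> b + c + 1"
    and "sorted_wrt (<) qs" "length qs = min d (a + 1)" "\<forall>q\<in>set qs. has_up a b c (int d - 1) q"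
  shows "matching_gf (lozenge_weight a x) (partial_region a b c (int d - 1) (set qs) {}) =
    cdet (map (path_weight x d) qs)"
  using assms(2-)
proof (induction d arbitrary: qs)
  case 0
  have "partial_region a b c (- 1) {} {} = {}"
    by (auto simp: partial_region_def has_up_def has_down_def)
  then show ?case using 0 by (simp add: matching_gf_empty cdet_Nil)
next
  case (Suc d)
  have d: "d \<le> b + c" using Suc.prems by simp
  then have d': "int d \<le> int b + int c" by simp
  have base: "matching_gf (lozenge_weight a x) (partial_region a b c (int d) {} (set ps)) =
        cdet (map (path_weight x d) ps)"
    if ps: "sorted_wrt (<) ps" "length ps = min (d + 1) (a + 1)"
      "\<forall>p\<in>set ps. has_down a b c (int d) p" for ps
  proof (cases "d \<le> a \<and> 2 * int d \<notin> set ps")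
    case True
    \<comment> \<open>Row \<open>d\<close> can be nonzero only in a column for height
      \<open>2 * d\<close>.\<close>
    have "cdet (map (path_weight x d) ps) = 0"
      using True ps(2) by (intro cdet_zero_row[where n = d]) (auto simp: path_weight_def)
    then show ?thesis
      using True by (simp add: matching_gf_blocked_strip[OF assms(1) _ d'])
  next
    case False
    have "matching_gf (lozenge_weight a x) (partial_region a b c (int d) {} (set ps)) =
        matching_gf (lozenge_weight a x) (partial_region a b c (int d - 1) (set ps) {})"
      using False by (intro matching_gf_forced_strip[OF assms(1) _ d']) auto
    also have "\<dots> = cdet (map (path_weight x d) ps)"
    proof (cases "d \<le> a")
      case True
      have ne: "ps \<noteq> []" using ps(2) by auto
      obtain ps' p where ps': "ps = ps' @ [p]" using ne by (cases ps rule: rev_cases) auto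
      have "2 * int d \<in> set ps" using False True by simp
      moreover have "\<forall>k\<in>set ps. k \<le> 2 * int d" using ps(3) by (auto simp: has_down_def)
      ultimately have p: "p = 2 * int d" and lt: "\<forall>k\<in>set ps'. k < 2 * int d"
        using ps(1) unfolding ps' by (fastforce simp: sorted_wrt_append)+
      have "\<not> has_up a b c (int d - 1) (2 * int d)"
        using True by (auto simp: has_up_def)
      then have "partial_region a b c (int d - 1) (set ps) {} = partial_region a b c (int d - 1) (set ps') {}"
        by (intro triangle_set_eqI) (auto simp: in_partial_region ps' p)
      also have "matching_gf (lozenge_weight a x) \<dots> = cdet (map (path_weight x d) ps')"
        using ps True lt d' assms(1)
        by (intro Suc.IH) (auto simp: ps' sorted_wrt_append has_up_iff_has_down)
      also have "\<dots> = cdet (map (path_weight x d) ps' @ [path_weight x d p])"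
        using ps(2) True lt by (intro cdet_snoc[symmetric]) (auto simp: ps' p path_weight_def)
      finally show ?thesis by (simp add: ps')
    next
      case False
      then show ?thesis
        using ps d' assms(1) by (intro Suc.IH) (auto simp: has_up_iff_has_down)
    qed
    finally show ?thesis .
  qed
  have "matching_gf (lozenge_weight a x) (partial_region a b c (int d) (set qs) (set [])) =
      cdet (map (path_weight x (Suc d)) qs @ map (path_weight x d) [])"
  proof (rule matching_gf_strip_eq_cdet[OF d])
    show "matching_gf (lozenge_weight a x) (partial_region a b c (int d) {} (set ps)) =
        cdet (map (path_weight x d) ps)"
      if "sorted_wrt (<) ps" "length ps = min (d + 1) (a + 1)"
        "\<forall>p\<in>set ps. has_down a b c (int d) p" for ps
      using that by (rule base)
  qed (use Suc.prems in simp_all)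
  then show ?case by simp
qed

section \<open>The determinants of the two regions\<close>

text \<open>The missing entry $b + 1$ is the dent.\<close>

definition end_positions :: "nat \<Rightarrow> nat \<Rightarrow> int list" where
  "end_positions b m = int b # [int b + 2..int b + int m + 1]"

text \<open>In the last strip \<open>b + c\<close> the heights run from \<open>b\<close> to
  \<open>b + min (b + c) a + 1\<close>. The minimum differs from \<open>a\<close> only for
  \<open>c = 0\<close>, \<open>a = b + 1\<close>.\<close>

lemma matching_gf_S_region:
  assumes "a \<le> b + 1"
  shows "matching_gf (lozenge_weight a x) (S_region a b c) =
    cdet (map (path_weight x (b + c + 1)) (end_positions b (min (b + c) a)))"
proof -
  let ?qs = "end_positions b (min (b + c) a)"
  have mem: "q \<in> set ?qs \<longleftrightarrow> has_up a b c (int b + int c) q \<and> q \<noteq> int b + 1" for q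
    unfolding end_positions_def has_up_def set_simps insert_iff set_upto atLeastAtMost_iff
      of_nat_min of_nat_add by linarith
  have "dent b c = up_at (int b + int c) (int b + 1)"
    by (simp add: dent_def up_at_def)
  moreover have "has_up a b c d k \<Longrightarrow> d \<le> int b + int c" "has_down a b c d k \<Longrightarrow> d \<le> int b + int c" for d k
    by (auto simp: has_up_def has_down_def)
  ultimately have "S_region a b c = partial_region a b c (int b + int c) (set ?qs) {}"
    unfolding S_region_def
  proof (intro triangle_set_eqI, goal_cases)
    case (1 e k)
    then show ?case
      by (cases "e = int b + int c")
        (auto simp: in_partial_region up_at_in_polygon_iff[OF assms] mem intro!: le_neq_trans)
  next
    case (2 e k)
    then show ?case
      by (cases "e = int b + int c")
        (auto simp: in_partial_region down_at_in_polygon_iff[OF assms] intro!: le_neq_trans)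
  qed
  moreover have "sorted_wrt (<) ?qs"
    by (auto simp: end_positions_def strict_sorted_iff)
  moreover have "length ?qs = min (b + c + 1) (a + 1)"
    by (auto simp: end_positions_def)
  moreover have "int (b + c + 1) - 1 = int b + int c" by simp
  ultimately show ?thesis
    using matching_gf_eq_cdet[OF assms, of "b + c + 1" c ?qs x] mem by simp
qed

lemma M_S_eq_cdet:
  assumes "a \<le> b + 1"
  shows "M_S a b c = cdet (map (path_weight 1 (b + c + 1)) (end_positions b (min (b + c) a)))"
proof -
  have "(\<lambda>_. 1) = lozenge_weight a 1" by (simp add: lozenge_weight_def fun_eq_iff)
  then show ?thesis unfolding M_S_def using matching_gf_S_region[OF assms] by simp
qed

lemma M_S'_eq_cdet:
  assumes "a \<le> b + 1"
  shows "M_S' a b c = cdet (map (path_weight (1 / 2) (b + c + 1)) (end_positions b (min (b + c) a)))"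
proof -
  have "M_S' a b c = matching_gf (lozenge_weight a (1 / 2)) (S_region a b c)"
    unfolding M_S'_def matching_gf_def
  proof (intro sum.cong prod.cong refl)
    fix T L assume "T \<in> lozenge_tilings (S_region a b c)" "L \<in> T"
    then have "L \<subseteq> S_region a b c" by (auto simp: lozenge_tilings_def partition_on_def)
    then show "S'_weight a b c L = lozenge_weight a (1 / 2) L"
      unfolding S'_weight_def lozenge_weight_def by metis
  qed
  then show ?thesis using matching_gf_S_region[OF assms] by simp
qed

section \<open>Comparing the determinants\<close>

text \<open>Absorption with \<open>n = d - i\<close> and \<open>u = p - 2 * i\<close>. In
  \<open>2 * n - u = 2 * d - p\<close> the row index cancels, so the factor splits into a row part
  and a column part.\<close>

lemma path_weight_half:
  assumes "i < d"
  shows "path_weight (1 / 2) d p i = 1 / (2 * (real d - real i)) * (2 * real d - of_int p) * path_weight 1 d p i"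
proof -
  obtain n where n: "d = Suc (i + n)" using assms less_imp_Suc_add by blast
  have "of_int (p - 2 * int i) * zbinom (Suc n) (p - 2 * int i) = real (Suc n) * zbinom n (p - 2 * int i - 1)"
    by (rule zbinom_absorb)
  then show ?thesis
    by (simp add: path_weight_def n zbinom_Suc field_simps)
qed

theorem theorem2p2:
  shows "(\<forall>a b c :: nat. a \<le> b \<longrightarrow>
            M_S' a b c =
              M_S a b c / 2 ^ (a + 1) * ((2 * real c + real b + 2) / (real c + real b + 1)) *
              (\<Prod>i = 1..a. (2 * real c + real b + 1 - real i) / (real c + real b + 1 - real i))) \<and>
         (\<forall>b c :: nat. M_S' (b + 1) b c = M_S' b b c)"
proof (intro conjI allI impI)
  fix a b c :: nat
  assume ab: "a \<le> b"
  let ?d = "b + c + 1" and ?qs = "end_positions b a"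
  have len: "length ?qs = a + 1" by (simp add: end_positions_def)
  have rows: "(\<Prod>i<a + 1. 1 / (2 * (real ?d - real i))) =
      1 / 2 ^ (a + 1) * (1 / (real c + real b + 1)) * (\<Prod>i = 1..a. 1 / (real c + real b + 1 - real i))"
  proof -
    have "{..<a + 1} = insert 0 {1..a}" by auto
    then have "(\<Prod>i<a + 1. 1 / (real ?d - real i)) =
        1 / (real c + real b + 1) * (\<Prod>i = 1..a. 1 / (real c + real b + 1 - real i))"
      by (simp add: algebra_simps)
    moreover have "(\<Prod>i<a + 1. 1 / (2 * (real ?d - real i))) =
        1 / 2 ^ (a + 1) * (\<Prod>i<a + 1. 1 / (real ?d - real i))"
    proof -
      have "(\<Prod>i<a + 1. 1 / (2 * (real ?d - real i))) = (\<Prod>i<a + 1. (1 / 2) * (1 / (real ?d - real i)))"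
        by simp
      then show ?thesis by (simp only: prod.distrib prod_constant card_lessThan power_one_over)
    qed
    ultimately show ?thesis by simp
  qed
  have cols: "(\<Prod>p\<leftarrow>?qs. 2 * real ?d - of_int p) =
      (2 * real c + real b + 2) * (\<Prod>i = 1..a. 2 * real c + real b + 1 - real i)"
  proof -
    \<comment> \<open>The end at height \<open>b\<close> gives the separate factor
      \<open>2 * c + b + 2\<close>; the ends \<open>b + 1 + i\<close> beyond the dent give the
      product.\<close>
    have "(\<Prod>p\<leftarrow>[int b + 2..int b + int a + 1]. 2 * real ?d - of_int p) =
        (\<Prod>p = int b + 2..int b + int a + 1. 2 * real ?d - of_int p)"
      by (simp flip: prod.distinct_set_conv_list)
    also have "\<dots> = (\<Prod>i = 1..a. 2 * real c + real b + 1 - real i)"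
      by (rule prod.reindex_bij_witness[where i = "\<lambda>i. int b + 1 + int i" and j = "\<lambda>p. nat (p - int b - 1)"]) auto
    finally show ?thesis by (simp add: end_positions_def algebra_simps)
  qed
  have "M_S' a b c = cdet (map (path_weight (1 / 2) ?d) ?qs)"
    using ab by (simp add: M_S'_eq_cdet)
  also have "\<dots> = (\<Prod>i<length ?qs. 1 / (2 * (real ?d - real i))) * (\<Prod>p\<leftarrow>?qs. 2 * real ?d - of_int p) *
      cdet (map (path_weight 1 ?d) ?qs)"
    using ab by (intro cdet_scale path_weight_half) (simp add: len)
  also have "cdet (map (path_weight 1 ?d) ?qs) = M_S a b c"
    using ab by (simp add: M_S_eq_cdet)
  finally show "M_S' a b c =
      M_S a b c / 2 ^ (a + 1) * ((2 * real c + real b + 2) / (real c + real b + 1)) *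
      (\<Prod>i = 1..a. (2 * real c + real b + 1 - real i) / (real c + real b + 1 - real i))"
    unfolding len rows cols by (simp add: prod_dividef)
next
  fix b c :: nat
  let ?f = "path_weight (1 / 2) (b + c + 1)"
  show "M_S' (b + 1) b c = M_S' b b c"
  \<comment> \<open>For \<open>c = 0\<close> the minimum \<open>min (b + c) a\<close> is
    \<open>b\<close> in both regions, so the determinants coincide.\<close>
  proof (cases "c = 0")
    case True
    then show ?thesis by (simp add: M_S'_eq_cdet)
  next
    case False
    have "end_positions b (b + 1) = end_positions b b @ [2 * int b + 2]"
      by (simp add: end_positions_def upto_rec2 add.commute)
    then have "M_S' (b + 1) b c = cdet (map ?f (end_positions b b) @ [?f (2 * int b + 2)])"
      using False by (simp add: M_S'_eq_cdet)
    also have "\<dots> = cdet (map ?f (end_positions b b))"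
    \<comment> \<open>The extra end has the starting height of row \<open>b + 1\<close>, so that
      path never rises and has weight 1. All other ends are lower, hence unreachable from this
      row.\<close>
    proof (rule cdet_snoc)
      have len: "length (map ?f (end_positions b b)) = b + 1" by (simp add: end_positions_def)
      show "?f (2 * int b + 2) (length (map ?f (end_positions b b))) = 1"
        using False unfolding len by (simp add: path_weight_def zbinom_def)
      show "g (length (map ?f (end_positions b b))) = 0" if "g \<in> set (map ?f (end_positions b b))" for g
        using that unfolding len by (auto simp: end_positions_def intro!: path_weight_eq_0)
    qed
    also have "\<dots> = M_S' b b c" by (simp add: M_S'_eq_cdet)
    finally show ?thesis .
  qed
qed

end
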